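(* For any $a,b\in\mathbb{N}_0$ and $c\in\mathbb{N}$, $$t^{\star}(\{2\}^{a},c+3,\{2\}^{b})=-\frac{2}{\pi}\sum_{r=1}^{c+2}2^{r}\sum_{\substack{s_1+\cdots+s_r=c+2\\ s_1,\ldots,s_r\geq1}}t(\overline{2a+1+s_1},s_2,\ldots,s_{r-1},2b+1+s_r),$$ where for $r=1$ the term $t(\overline{2a+1+s_1},s_2,\ldots,s_{r-1},2b+1+s_r)$ means $t(\overline{2a+2b+4+c})$.
   Context: $t^{\star}(\boldsymbol{s})=\sum_{k_1\geq\cdots\geq k_r\geq1}\prod_{j}(2k_j-1)^{-s_j}$ for an index with $s_1>1$; $\{2\}^a$ is $2$ repeated $a$ times. Alternating multiple $t$-values: $t(\boldsymbol{s};\boldsymbol{\sigma})=\sum_{k_1>\cdots>k_r\geq1}\prod_{j}\frac{\sigma_j^{k_j}}{(2k_j-1)^{s_j}}$, where a bar over $s_j$ means $\sigma_j=-1$ and no bar means $\sigma_j=1$ (so only the first argument carries sign $-1$ here). *)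

theory Defs
  imports "HOL-Analysis.Analysis"
begin

definition tstar :: "nat list \<Rightarrow> real" where
  "tstar s = infsum (\<lambda>k::nat list. \<Prod>j<length s. 1 / (2 * real (k ! j) - 1) ^ (s ! j))
     {k. length k = length s \<and> sorted_wrt (\<ge>) k \<and> (\<forall>x\<in>set k. 1 \<le> x)}"

definition tval :: "nat list \<Rightarrow> real list \<Rightarrow> real" where
  "tval s \<sigma> = infsum (\<lambda>k::nat list. \<Prod>j<length s. (\<sigma> ! j) ^ (k ! j) / (2 * real (k ! j) - 1) ^ (s ! j))
     {k. length k = length s \<and> sorted_wrt (>) k \<and> (\<forall>x\<in>set k. 1 \<le> x)}"

definition compositions :: "nat \<Rightarrow> nat \<Rightarrow> nat list set" where
  "compositions n r = {s. length s = r \<and> (\<forall>x\<in>set s. 1 \<le> x) \<and> sum_list s = n}"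

text \<open>The argument list (2a+1+s_1, s_2, ..., s_{r-1}, 2b+1+s_r); for r = 1 this is
  (2a+2b+2+s_1).\<close>
definition shift_ends :: "nat \<Rightarrow> nat \<Rightarrow> nat list \<Rightarrow> nat list" where
  "shift_ends a b s = map (\<lambda>j. s ! j + (if j = 0 then 2 * a + 1 else 0)
      + (if j = length s - 1 then 2 * b + 1 else 0)) [0..<length s]"

end

theory Submission
  imports Defs
begin

text \<open>
  Write \<open>m\<^sub>n = 2n - 1\<close> and \<open>P\<^sub>k(n) = \<Prod>\<^sub>j\<^sub><\<^sub>k (1 - m\<^sub>n\<^sup>2 / m\<^sub>j\<^sup>2)\<close>. A partial fraction expansion of the
  generating function of the leading twos, truncated at \<open>k\<^sub>1 \<le> N\<close>, turns the star sum into
  \<open>\<Sum>\<^sub>n w\<^sub>n\<^sub>,\<^sub>N m\<^sub>n\<^sup>-\<^sup>2\<^sup>a F\<^sub>c\<^sub>+\<^sub>2(n)\<close> with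
  \<open>F\<^sub>p(n) = \<Sum>\<^sub>k P\<^sub>k(n) m\<^sub>k\<^sup>-\<^sup>p\<^sup>-\<^sup>1 t\<^sup>\<star>\<^sub>\<le>\<^sub>k({2}\<^sup>b)\<close>, where by Wallis' product the weights
  \<open>w\<^sub>n\<^sub>,\<^sub>N\<close> tend to \<open>(4/\<pi>) (-1)\<^sup>n\<^sup>-\<^sup>1 / m\<^sub>n\<close> and are dominated, so Tannery's theorem applies.

  The key point is that every \<open>P\<^sub>k\<close> is an eigenfunction, with eigenvalue \<open>1 / m\<^sub>k\<close>, of the operator
  \<open>(L f)(n) = (f(n) + 2 \<Sum>\<^sub>l\<^sub><\<^sub>n f(l)) / m\<^sub>n\<close>. Hence \<open>F\<^sub>p\<^sub>+\<^sub>1 = L F\<^sub>p\<close>, starting from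
  \<open>F\<^sub>1(n) = m\<^sub>n\<^sup>-\<^sup>2\<^sup>b\<^sup>-\<^sup>2\<close>. The sum over compositions weighted by \<open>2\<^sup>r\<close> obeys the same recursion: a
  composition of \<open>p + 1\<close> arises from one of \<open>p\<close> by increasing its first part (the term \<open>f(n)\<close>) or by
  prepending a part 1 (the term \<open>2 \<Sum>\<^sub>l\<^sub><\<^sub>n f(l)\<close>).
\<close>

section \<open>Odd numbers and the polynomials \<open>odd_poly\<close>\<close>

definition odd_num :: "nat \<Rightarrow> real" where
  "odd_num n = 2 * real n - 1"

lemma odd_num_ne_0 [simp]: "odd_num n \<noteq> 0"
proof
  assume "odd_num n = 0"
  hence "real (2 * n) = real 1" by (simp add: odd_num_def)
  hence "2 * n = 1" by (simp only: of_nat_eq_iff)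
  thus False by presburger
qed

lemma odd_num_ge: "1 \<le> n \<Longrightarrow> odd_num n \<ge> real n"
  by (simp add: odd_num_def)

lemma odd_num_pos: "1 \<le> n \<Longrightarrow> odd_num n > 0"
  by (simp add: odd_num_def)

definition odd_poly :: "nat \<Rightarrow> nat \<Rightarrow> real" where
  "odd_poly k n = (\<Prod>j = 1..<k. 1 - (odd_num n / odd_num j)\<^sup>2)"

lemma odd_poly_1 [simp]: "odd_poly (Suc 0) n = 1"
  by (simp add: odd_poly_def)

lemma odd_poly_Suc:
  assumes "1 \<le> k"
  shows "odd_poly (Suc k) n = odd_poly k n * (1 - (odd_num n / odd_num k)\<^sup>2)"
  using assms by (simp add: odd_poly_def atLeastLessThanSuc)

lemma odd_poly_eq_0:
  assumes "1 \<le> n" "n < k"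
  shows "odd_poly k n = 0"
  unfolding odd_poly_def using assms by (intro prod_zero) (auto intro!: bexI[of _ n])

lemma odd_num_ratio:
  "1 - (odd_num n / odd_num k)\<^sup>2 = 4 * (real k - real n) * (real k + real n - 1) / (odd_num k)\<^sup>2"
proof -
  have "1 - (odd_num n / odd_num k)\<^sup>2 = ((odd_num k)\<^sup>2 - (odd_num n)\<^sup>2) / (odd_num k)\<^sup>2"
    by (simp add: power_divide diff_divide_distrib)
  also have "(odd_num k)\<^sup>2 - (odd_num n)\<^sup>2 = 4 * (real k - real n) * (real k + real n - 1)"
    by (simp add: odd_num_def power2_eq_square algebra_simps)
  finally show ?thesis .
qed

text \<open>By \<open>odd_num_ratio\<close>, \<open>odd_poly k n\<close> is, up to a factor
  depending only on k, the product of the consecutive integers from n - k + 1 to n + k - 2. Passing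
  to n + 1 drops the lowest of them and gains n + k - 1. Both the eigenfunction property and the
  orthogonality below rest on this relation.\<close>

lemma odd_poly_shift:
  assumes "1 \<le> k"
  shows "(real n + 1 - real k) * odd_poly k (Suc n) = (real n + real k - 1) * odd_poly k n"
  using assms
proof (induction k rule: nat_induct_at_least)
  case base
  thus ?case by simp
next
  case (Suc k)
  define C where "C = 4 / (odd_num k)\<^sup>2"
  have "(real n + 1 - real (Suc k)) * odd_poly (Suc k) (Suc n) =
      ((real n + 1 - real k) * odd_poly k (Suc n)) * (C * (real k - real n) * (real k + real n))"
    unfolding odd_poly_Suc[OF Suc.hyps] odd_num_ratio C_def by (simp add: algebra_simps)
  also have "\<dots> = (real n + real (Suc k) - 1) * odd_poly (Suc k) n"
    unfolding Suc.IH using Suc.hyps by (simp add: odd_poly_Suc odd_num_ratio C_def algebra_simps)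
  finally show ?case .
qed

text \<open>One more factor of the product changes it by
  \<open>odd_poly i n * (odd_num n / odd_num i)^2\<close>, so the summands are differences up to the
  constant \<open>(odd_num n)^2\<close>. The upper end contributes nothing because
  \<open>odd_poly (Suc n) n\<close> is 0.\<close>

lemma odd_poly_telescope:
  assumes "1 \<le> n" "1 \<le> k" "k \<le> Suc n"
  shows "(\<Sum>i = k..n. odd_poly i n / (odd_num i)\<^sup>2) = odd_poly k n / (odd_num n)\<^sup>2"
proof -
  have "odd_poly i n / (odd_num i)\<^sup>2 = (odd_poly i n - odd_poly (Suc i) n) / (odd_num n)\<^sup>2"
    if "1 \<le> i" for i
    using that by (simp add: odd_poly_Suc field_simps)
  hence "(\<Sum>i = k..n. odd_poly i n / (odd_num i)\<^sup>2) =
      (\<Sum>i = k..n. odd_poly i n - odd_poly (Suc i) n) / (odd_num n)\<^sup>2"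
    using assms by (subst sum_divide_distrib) (intro sum.cong, auto)
  also have "(\<Sum>i = k..n. odd_poly i n - odd_poly (Suc i) n) = odd_poly k n - odd_poly (Suc n) n"
    using assms(3) sum_Suc_diff[of k n "\<lambda>i. - odd_poly i n"] by simp
  finally show ?thesis using assms by (simp add: odd_poly_eq_0)
qed

section \<open>Partial fraction weights\<close>

text \<open>
  \<open>lag_coeff n N / m\<^sub>n\<close> is the partial fraction weight \<open>\<Prod>\<^sub>j\<^sub>\<le>\<^sub>N\<^sub>,\<^sub>j\<^sub>\<noteq>\<^sub>n (1 - m\<^sub>n\<^sup>2 / m\<^sub>j\<^sup>2)\<^sup>-\<^sup>1\<close>, factored into
  its value at \<open>n = 1\<close> and a ratio that vanishes for \<open>n > N\<close>.
\<close>

definition lag_ratio :: "nat \<Rightarrow> nat \<Rightarrow> real" where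
  "lag_ratio n N = (\<Prod>i = 1..<n. - (real N - real i) / (real N + real i))"

definition lag_first :: "nat \<Rightarrow> real" where
  "lag_first N = (\<Prod>j = 1..<N. (odd_num (Suc j))\<^sup>2 / (4 * real j * real (Suc j)))"

definition lag_coeff :: "nat \<Rightarrow> nat \<Rightarrow> real" where
  "lag_coeff n N = lag_first N * lag_ratio n N"

lemma lag_ratio_Suc:
  "1 \<le> n \<Longrightarrow> lag_ratio (Suc n) N = lag_ratio n N * (- (real N - real n) / (real N + real n))"
  by (simp add: lag_ratio_def atLeastLessThanSuc)

lemma lag_first_Suc:
  "1 \<le> N \<Longrightarrow> lag_first (Suc N) = lag_first N * ((odd_num (Suc N))\<^sup>2 / (4 * real N * real (Suc N)))"
  by (simp add: lag_first_def atLeastLessThanSuc)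

lemma lag_coeff_Suc_left:
  assumes "1 \<le> n"
  shows "(real N + real n) * lag_coeff (Suc n) N = - (real N - real n) * lag_coeff n N"
  using assms by (simp add: lag_coeff_def lag_ratio_Suc)

text \<open>Kept free of denominators so that n = N + 1, where the factor N + 1 - n vanishes, is
  covered as well.\<close>

lemma lag_ratio_Suc_right:
  assumes "1 \<le> n" "1 \<le> N"
  shows "(real N + 1 - real n) * (real N + real n) * lag_ratio n (Suc N) =
    real N * (real N + 1) * lag_ratio n N"
  using assms(1)
proof (induction n rule: nat_induct_at_least)
  case base
  thus ?case by (simp add: lag_ratio_def algebra_simps)
next
  case (Suc n)
  have "(real N + 1 - real (Suc n)) * (real N + real (Suc n)) * lag_ratio (Suc n) (Suc N) =
      - (real N - real n) / (real N + real n) *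
        ((real N + 1 - real n) * (real N + real n) * lag_ratio n (Suc N))"
    using Suc.hyps by (simp add: lag_ratio_Suc divide_simps) (simp add: algebra_simps)
  also have "\<dots> = real N * (real N + 1) * lag_ratio (Suc n) N"
    unfolding Suc.IH using Suc.hyps by (simp add: lag_ratio_Suc)
  finally show ?case .
qed

lemma lag_coeff_Suc_right:
  assumes "1 \<le> n" "1 \<le> N"
  shows "lag_coeff n (Suc N) * (1 - (odd_num n / odd_num (Suc N))\<^sup>2) = lag_coeff n N"
proof -
  define A where "A = (odd_num (Suc N))\<^sup>2"
  define X where "X = real N + 1 - real n"
  define Y where "Y = real N + real n"
  have A: "A \<noteq> 0" by (simp add: A_def)
  have XY: "real (Suc N) - real n = X" "real (Suc N) + real n - 1 = Y"
    by (simp_all add: X_def Y_def)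
  have "lag_coeff n (Suc N) * (1 - (odd_num n / odd_num (Suc N))\<^sup>2) =
    lag_first N * (A / (4 * real N * (real N + 1))) * (4 / A) *
      ((real N + 1 - real n) * (real N + real n) * lag_ratio n (Suc N))"
    unfolding odd_num_ratio lag_coeff_def lag_first_Suc[OF assms(2)] A_def[symmetric] XY
    unfolding X_def[symmetric] Y_def[symmetric] by (simp add: add.commute)
  also have "\<dots> = lag_coeff n N"
    unfolding lag_ratio_Suc_right[OF assms] using assms A by (simp add: lag_coeff_def)
  finally show ?thesis .
qed

lemma lag_coeff_eq_0:
  assumes "1 \<le> N" "N < n"
  shows "lag_coeff n N = 0"
  unfolding lag_coeff_def lag_ratio_def using assms
  by (auto intro!: prod_zero bexI[of _ N])

text \<open>At n = N the partial fraction weight is the reciprocal of \<open>odd_poly N N\<close>.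
  The factored definition hides this, so the induction walks from (N, N) to (N, N + 1) by
  \<open>lag_coeff_Suc_right\<close> and on to (N + 1, N + 1) by
  \<open>lag_coeff_Suc_left\<close>.\<close>

lemma lag_coeff_diag:
  assumes "1 \<le> N"
  shows "lag_coeff N N * odd_poly N N = odd_num N"
  using assms
proof (induction N rule: nat_induct_at_least)
  case base
  thus ?case by (simp add: lag_coeff_def lag_first_def lag_ratio_def odd_num_def)
next
  case (Suc N)
  define q where "q = odd_num N"
  have q: "q \<noteq> 0" "real N = (q + 1) / 2" "odd_num (Suc N) = q + 2" and N: "real N \<noteq> 0"
    and q2: "q + 2 \<noteq> 0" "q + 1 \<noteq> 0"
    using Suc.hyps by (auto simp: q_def odd_num_def)
  have P: "odd_poly N (Suc N) = q * odd_poly N N"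
    using odd_poly_shift[OF Suc.hyps, of N] by (simp add: q_def odd_num_def)
  have 1: "odd_poly (Suc N) (Suc N) = q * odd_poly N N * (1 - ((q + 2) / q)\<^sup>2)"
    using Suc.hyps by (simp add: odd_poly_Suc P q(3) flip: q_def)
  have 2: "(q + 2) * lag_coeff (Suc N) (Suc N) = - lag_coeff N (Suc N)"
    using lag_coeff_Suc_left[OF Suc.hyps, of "Suc N"] by (simp add: q algebra_simps)
  have 3: "lag_coeff N (Suc N) * (1 - (q / (q + 2))\<^sup>2) = lag_coeff N N"
    using lag_coeff_Suc_right[OF Suc.hyps Suc.hyps] by (simp add: q(3) flip: q_def)
  have "(q + 2) * (lag_coeff (Suc N) (Suc N) * odd_poly (Suc N) (Suc N)) =
      - lag_coeff N (Suc N) * (q * odd_poly N N * (1 - ((q + 2) / q)\<^sup>2))"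
    unfolding 1 using 2 by (metis mult.assoc)
  also have "\<dots> = (q + 2)\<^sup>2 / q * odd_poly N N * (lag_coeff N (Suc N) * (1 - (q / (q + 2))\<^sup>2))"
  proof -
    have "1 - ((q + 2) / q)\<^sup>2 = - (4 * q + 4) / q\<^sup>2"
      using q(1) by (simp add: divide_simps) (simp add: power2_eq_square algebra_simps)
    moreover have "1 - (q / (q + 2))\<^sup>2 = (4 * q + 4) / (q + 2)\<^sup>2"
      using q2(1) by (simp add: divide_simps) (simp add: power2_eq_square algebra_simps)
    ultimately show ?thesis using q(1) q2(1)
      by (simp add: power2_eq_square) (simp add: field_simps)
  qed
  also have "\<dots> = (q + 2)\<^sup>2 / q * (lag_coeff N N * odd_poly N N)"
    unfolding 3 by simp
  also have "\<dots> = (q + 2) * (q + 2)"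
    unfolding Suc.IH using q by (simp add: q_def power2_eq_square)
  finally show ?case using q2 q by simp
qed

text \<open>This inverts the triangular matrix with entries \<open>odd_poly k n\<close>. For k = N
  only n = N survives. For k < N the sum telescopes, and both boundary values vanish: at N + 1
  through \<open>lag_coeff\<close>, at 1 through the factor n - k if k = 1 and through
  \<open>odd_poly k 1\<close> otherwise.\<close>

lemma lag_coeff_orthogonal:
  assumes "1 \<le> k" "k \<le> N"
  shows "(\<Sum>n = 1..N. lag_coeff n N * odd_num n * odd_poly k n) = (if k = N then (odd_num N)\<^sup>2 else 0)"
proof (cases "k = N")
  case True
  have "(\<Sum>n = 1..N. lag_coeff n N * odd_num n * odd_poly k n) =
      (\<Sum>n \<in> {N}. lag_coeff n N * odd_num n * odd_poly k n)"
    using True assms by (intro sum.mono_neutral_right) (auto simp: odd_poly_eq_0)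
  also have "\<dots> = (odd_num N)\<^sup>2"
    using lag_coeff_diag[of N] True assms by (simp add: power2_eq_square)
  finally show ?thesis using True by simp
next
  case False
  \<comment> \<open>antidifference found by Gosper's algorithm\<close>
  define T where "T n = - lag_coeff n N * odd_poly k n * ((real n - real k) * (real N + real n - 1))" for n
  have T: "(real N - real k) * (lag_coeff n N * odd_num n * odd_poly k n) = T (Suc n) - T n"
    if "1 \<le> n" for n
  proof -
    have "T (Suc n) = - ((real N + real n) * lag_coeff (Suc n) N) *
        ((real n + 1 - real k) * odd_poly k (Suc n))"
      by (simp add: T_def)
    also have "\<dots> = (real N - real n) * lag_coeff n N * ((real n + real k - 1) * odd_poly k n)"
      unfolding lag_coeff_Suc_left[OF that] odd_poly_shift[OF assms(1)]
      by (simp add: algebra_simps)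
    finally show ?thesis by (simp add: T_def odd_num_def algebra_simps)
  qed
  have "(real N - real k) * (\<Sum>n = 1..N. lag_coeff n N * odd_num n * odd_poly k n) =
      (\<Sum>n = 1..N. T (Suc n) - T n)"
    by (subst sum_distrib_left) (intro sum.cong, auto simp: T)
  also have "\<dots> = T (Suc N) - T 1"
    using assms sum_Suc_diff[of 1 N T] by simp
  also have "T (Suc N) = 0"
    using assms by (simp add: T_def lag_coeff_eq_0)
  also have "T 1 = 0"
    using assms odd_poly_eq_0[of 1 k] by (cases "k = 1") (simp_all add: T_def)
  finally show ?thesis using False assms by simp
qed

text \<open>The tool for prepending a 2 to a star sum. By \<open>lag_coeff_Suc_right\<close>,
  raising N to N + 1 changes \<open>lag_coeff n N\<close> by
  \<open>lag_coeff n (Suc N) * (odd_num n / odd_num (Suc N))^2\<close>; after division by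
  \<open>(odd_num n)^2\<close> this is exactly the new summand.\<close>

lemma lag_coeff_partial_sum:
  assumes "\<And>N. 1 \<le> N \<Longrightarrow> f N = (\<Sum>n = 1..N. lag_coeff n N * g n)"
  shows "(\<Sum>i = 1..N. f i / (odd_num i)\<^sup>2) = (\<Sum>n = 1..N. lag_coeff n N * (g n / (odd_num n)\<^sup>2))"
proof (induction N)
  case 0
  show ?case by simp
next
  case (Suc N)
  have step: "lag_coeff n N * (g n / (odd_num n)\<^sup>2) + lag_coeff n (Suc N) * g n / (odd_num (Suc N))\<^sup>2 =
      lag_coeff n (Suc N) * (g n / (odd_num n)\<^sup>2)" if "n \<in> {1..N}" for n
    using that by (subst lag_coeff_Suc_right[symmetric]) (auto simp: field_simps)
  have "(\<Sum>i = 1..Suc N. f i / (odd_num i)\<^sup>2) =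
      (\<Sum>n = 1..N. lag_coeff n N * (g n / (odd_num n)\<^sup>2)) +
      (\<Sum>n = 1..Suc N. lag_coeff n (Suc N) * g n / (odd_num (Suc N))\<^sup>2)"
    using Suc.IH by (simp add: assms sum_divide_distrib add_divide_distrib)
  also have "\<dots> = (\<Sum>n = 1..N. lag_coeff n N * (g n / (odd_num n)\<^sup>2) +
      lag_coeff n (Suc N) * g n / (odd_num (Suc N))\<^sup>2) +
      lag_coeff (Suc N) (Suc N) * (g (Suc N) / (odd_num (Suc N))\<^sup>2)"
    by (simp add: sum.distrib)
  also have "\<dots> = (\<Sum>n = 1..Suc N. lag_coeff n (Suc N) * (g n / (odd_num n)\<^sup>2))"
    using step by simp
  finally show ?case .
qed

section \<open>The triangular transform and the averaging operator\<close>

text \<open>Stopping at k = n loses nothing, since \<open>odd_poly k n\<close> vanishes for k > n;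
  extending the range is what permits the exchanges of summation below.\<close>

definition odd_transform :: "(nat \<Rightarrow> real) \<Rightarrow> nat \<Rightarrow> real" where
  "odd_transform R n = (\<Sum>k = 1..n. odd_poly k n * R k)"

lemma odd_transform_inverse:
  assumes "1 \<le> N"
  shows "(\<Sum>n = 1..N. lag_coeff n N * (odd_num n * odd_transform R n)) = (odd_num N)\<^sup>2 * R N"
proof -
  have "odd_transform R n = (\<Sum>k = 1..N. odd_poly k n * R k)" if "n \<in> {1..N}" for n
    unfolding odd_transform_def using that
    by (intro sum.mono_neutral_left) (auto simp: odd_poly_eq_0)
  hence "(\<Sum>n = 1..N. lag_coeff n N * (odd_num n * odd_transform R n)) =
      (\<Sum>n = 1..N. \<Sum>k = 1..N. R k * (lag_coeff n N * odd_num n * odd_poly k n))"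
    by (intro sum.cong) (auto simp: sum_distrib_left mult_ac)
  also have "\<dots> = (\<Sum>k = 1..N. R k * (\<Sum>n = 1..N. lag_coeff n N * odd_num n * odd_poly k n))"
    by (subst sum.swap) (simp add: sum_distrib_left)
  also have "\<dots> = (\<Sum>k = 1..N. if k = N then R k * (odd_num N)\<^sup>2 else 0)"
    using lag_coeff_orthogonal[of _ N] by (intro sum.cong refl) simp
  finally show ?thesis using assms by (simp add: sum.delta)
qed

definition odd_avg :: "(nat \<Rightarrow> real) \<Rightarrow> nat \<Rightarrow> real" where
  "odd_avg f n = (f n + 2 * (\<Sum>l = 1..<n. f l)) / odd_num n"

text \<open>With denominators cleared, the induction step over n is twice
  \<open>odd_poly_shift\<close>, because \<open>odd_num (Suc n) - odd_num k\<close> is 2(n + 1 - k)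
  and \<open>odd_num n + odd_num k\<close> is 2(n + k - 1).\<close>

lemma odd_avg_odd_poly:
  assumes "1 \<le> k" "1 \<le> n"
  shows "odd_avg (odd_poly k) n = odd_poly k n / odd_num k"
proof -
  have "odd_num k * (odd_poly k n + 2 * (\<Sum>l = 1..<n. odd_poly k l)) = odd_num n * odd_poly k n"
    using assms(2)
  proof (induction n rule: nat_induct_at_least)
    case base
    show ?case using assms(1) odd_poly_eq_0[of 1 k]
      by (cases "k = 1") (simp_all add: odd_num_def)
  next
    case (Suc n)
    have "(odd_num (Suc n) - odd_num k) * odd_poly k (Suc n) = (odd_num n + odd_num k) * odd_poly k n"
      using odd_poly_shift[OF assms(1), of n] by (simp add: odd_num_def algebra_simps)
    thus ?case using Suc by (simp add: algebra_simps)
  qed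
  thus ?thesis by (simp add: odd_avg_def divide_simps mult_ac)
qed

lemma odd_avg_odd_transform:
  assumes "1 \<le> n"
  shows "odd_avg (odd_transform R) n = odd_transform (\<lambda>k. R k / odd_num k) n"
proof -
  have *: "odd_transform R l = (\<Sum>k = 1..n. R k * odd_poly k l)" if "l \<in> {1..n}" for l
    unfolding odd_transform_def using that
    by (subst mult.commute, intro sum.mono_neutral_left) (auto simp: odd_poly_eq_0)
  have "(\<Sum>l = 1..<n. odd_transform R l) = (\<Sum>l = 1..<n. \<Sum>k = 1..n. R k * odd_poly k l)"
    by (intro sum.cong refl *) auto
  also have "\<dots> = (\<Sum>k = 1..n. R k * (\<Sum>l = 1..<n. odd_poly k l))"
    by (subst sum.swap) (simp add: sum_distrib_left)
  finally have "odd_avg (odd_transform R) n = (\<Sum>k = 1..n. R k * odd_avg (odd_poly k) n)"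
    using assms *[of n]
    by (simp add: odd_avg_def sum_divide_distrib sum_distrib_left sum.distrib algebra_simps add_divide_distrib)
  also have "\<dots> = odd_transform (\<lambda>k. R k / odd_num k) n"
    unfolding odd_transform_def using assms by (intro sum.cong) (auto simp: odd_avg_odd_poly)
  finally show ?thesis .
qed

section \<open>Nested sums and their finite transforms\<close>

text \<open>The gap \<open>d\<close> between consecutive indices is 0 for star sums and 1 for strict sums.\<close>

primrec nested_sum :: "nat \<Rightarrow> (nat \<Rightarrow> real) list \<Rightarrow> nat \<Rightarrow> real" where
  "nested_sum d [] N = 1"
| "nested_sum d (f # fs) N = (\<Sum>k = 1..N. f k * nested_sum d fs (k - d))"

abbreviation odd_recip :: "nat \<Rightarrow> nat \<Rightarrow> real" where
  "odd_recip s k \<equiv> 1 / odd_num k ^ s"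

lemma sum_triangle_swap:
  fixes f :: "nat \<Rightarrow> nat \<Rightarrow> real"
  shows "(\<Sum>k = 1..n. \<Sum>i = 1..k. f k i) = (\<Sum>i = 1..n. \<Sum>k = i..n. f k i)"
  by (simp add: sum.Sigma, rule sum.reindex_bij_witness[of _ prod.swap prod.swap]) auto

text \<open>Exchanging the two outermost summations leaves \<open>odd_poly_telescope\<close> as the
  inner sum, so each further 2 costs one factor \<open>1 / (odd_num n)^2\<close>.\<close>

lemma odd_transform_nested_twos:
  assumes "1 \<le> n"
  shows "odd_transform (\<lambda>k. nested_sum 0 (replicate b (odd_recip 2)) k / (odd_num k)\<^sup>2) n =
    odd_recip (2 * b + 2) n"
proof (induction b)
  case 0
  show ?case using odd_poly_telescope[of n 1] assms
    by (simp add: odd_transform_def power2_eq_square)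
next
  case (Suc b)
  define h where "h = nested_sum 0 (replicate b (odd_recip 2))"
  have "odd_transform (\<lambda>k. nested_sum 0 (replicate (Suc b) (odd_recip 2)) k / (odd_num k)\<^sup>2) n =
      (\<Sum>k = 1..n. \<Sum>i = 1..k. h i / (odd_num i)\<^sup>2 * (odd_poly k n / (odd_num k)\<^sup>2))"
    by (simp add: odd_transform_def h_def sum_divide_distrib sum_distrib_left mult_ac)
  also have "\<dots> = (\<Sum>i = 1..n. h i / (odd_num i)\<^sup>2 * (\<Sum>k = i..n. odd_poly k n / (odd_num k)\<^sup>2))"
    by (subst sum_triangle_swap) (simp only: sum_distrib_left)
  also have "\<dots> = (\<Sum>i = 1..n. odd_poly i n * (h i / (odd_num i)\<^sup>2) / (odd_num n)\<^sup>2)"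
  proof (intro sum.cong refl)
    fix i assume "i \<in> {1..n}"
    thus "h i / (odd_num i)\<^sup>2 * (\<Sum>k = i..n. odd_poly k n / (odd_num k)\<^sup>2) =
        odd_poly i n * (h i / (odd_num i)\<^sup>2) / (odd_num n)\<^sup>2"
      using assms by (subst odd_poly_telescope) auto
  qed
  also have "\<dots> = odd_transform (\<lambda>k. h k / (odd_num k)\<^sup>2) n / (odd_num n)\<^sup>2"
    unfolding odd_transform_def by (rule sum_divide_distrib[symmetric])
  also have "\<dots> = odd_recip (2 * Suc b + 2) n"
    using Suc.IH by (simp add: h_def power2_eq_square)
  finally show ?case .
qed

lemma odd_avg_cong:
  assumes "1 \<le> n" "\<And>l. 1 \<le> l \<Longrightarrow> f l = g l"
  shows "odd_avg f n = odd_avg g n"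
  using assms by (simp add: odd_avg_def)

text \<open>By \<open>odd_avg_odd_transform\<close>, raising the exponent by one is one application
  of \<open>odd_avg\<close>. The count starts at exponent 2, so the left side is the function F with
  index p + 1 of the introduction.\<close>

lemma odd_transform_iterate:
  assumes "1 \<le> n"
  shows "odd_transform (\<lambda>k. odd_recip (p + 2) k * nested_sum 0 (replicate b (odd_recip 2)) k) n =
    (odd_avg ^^ p) (odd_recip (2 * b + 2)) n"
  using assms
proof (induction p arbitrary: n)
  case 0
  thus ?case using odd_transform_nested_twos[of n b] by (simp add: power2_eq_square)
next
  case (Suc p)
  have "odd_transform (\<lambda>k. odd_recip (Suc p + 2) k * nested_sum 0 (replicate b (odd_recip 2)) k) n =
      odd_avg (odd_transform (\<lambda>k. odd_recip (p + 2) k * nested_sum 0 (replicate b (odd_recip 2)) k)) n"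
    using Suc.prems by (simp add: odd_avg_odd_transform mult_ac)
  also have "\<dots> = odd_avg ((odd_avg ^^ p) (odd_recip (2 * b + 2))) n"
    using Suc by (intro odd_avg_cong)
  finally show ?case by simp
qed

lemma nested_sum_leading_twos:
  "nested_sum 0 (replicate a (odd_recip 2) @ f # fs) N =
    (\<Sum>n = 1..N. lag_coeff n N * (odd_transform (\<lambda>k. f k * nested_sum 0 fs k) n / odd_num n ^ (2 * a + 1)))"
proof (induction a arbitrary: N)
  case 0
  define R where "R = (\<lambda>k. f k * nested_sum 0 fs k)"
  \<comment> \<open>The factor \<open>(odd_num i)^2\<close> produced by
    \<open>odd_transform_inverse\<close> cancels the weight in \<open>lag_coeff_partial_sum\<close>,
    leaving the plain partial sum of \<open>R\<close>.\<close>
  have "(\<Sum>i = 1..N. (odd_num i)\<^sup>2 * R i / (odd_num i)\<^sup>2) =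
      (\<Sum>n = 1..N. lag_coeff n N * (odd_num n * odd_transform R n / (odd_num n)\<^sup>2))"
    by (rule lag_coeff_partial_sum) (rule odd_transform_inverse[symmetric])
  thus ?case by (simp add: R_def power2_eq_square)
next
  case (Suc a)
  have "(\<Sum>i = 1..N. nested_sum 0 (replicate a (odd_recip 2) @ f # fs) i / (odd_num i)\<^sup>2) =
      (\<Sum>n = 1..N. lag_coeff n N *
        (odd_transform (\<lambda>k. f k * nested_sum 0 fs k) n / odd_num n ^ (2 * a + 1) / (odd_num n)\<^sup>2))"
    by (rule lag_coeff_partial_sum) (rule Suc.IH)
  thus ?case by (simp add: power2_eq_square mult_ac)
qed

section \<open>Limits of the weights and passage to the infinite series\<close>

text \<open>Multiplying the j-th factors of both products gives (2j + 1)/(2j - 1) times j/(j + 1),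
  which telescopes.\<close>

lemma lag_first_wallis:
  "lag_first (Suc N) * (\<Prod>k = 1..N. (4 * (real k)\<^sup>2) / (4 * (real k)\<^sup>2 - 1)) = (2 * real N + 1) / (real N + 1)"
proof (induction N)
  case 0
  show ?case by (simp add: lag_first_def)
next
  case (Suc N)
  define x where "x = real N + 1"
  define W where "W = (\<Prod>k = 1..N. (4 * (real k)\<^sup>2) / (4 * (real k)\<^sup>2 - 1))"
  have x: "real (Suc N) = x" "real N = x - 1" "x \<ge> 1" by (simp_all add: x_def)
  have nz: "2 * x - 1 \<noteq> 0" "2 * x + 1 \<noteq> 0" "4 * x\<^sup>2 - 1 = (2 * x - 1) * (2 * x + 1)"
    using x by (auto simp: power2_eq_square algebra_simps)
  have "lag_first (Suc (Suc N)) * (\<Prod>k = 1..Suc N. (4 * (real k)\<^sup>2) / (4 * (real k)\<^sup>2 - 1)) =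
      (lag_first (Suc N) * W) * ((2 * x + 1)\<^sup>2 / (4 * x * (x + 1)) * ((4 * x\<^sup>2) / (4 * x\<^sup>2 - 1)))"
    by (simp add: lag_first_Suc W_def odd_num_def x_def algebra_simps)
  also have "\<dots> = ((2 * x - 1) / x) * ((2 * x + 1)\<^sup>2 / (4 * x * (x + 1)) * ((4 * x\<^sup>2) / (4 * x\<^sup>2 - 1)))"
    unfolding W_def Suc.IH by (simp add: x_def)
  also have "\<dots> = (2 * x + 1) / (x + 1)"
    unfolding nz(3) using x(3) nz(1,2) by (simp add: divide_simps power2_eq_square)
  finally show ?case by (simp add: x_def algebra_simps)
qed

lemma tendsto_const_over_shift: "(\<lambda>N. c / (real N + real i)) \<longlonglongrightarrow> 0"
  using LIMSEQ_ignore_initial_segment[OF lim_const_over_n[of c], of i] by simp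

lemma lag_first_tendsto: "lag_first \<longlonglongrightarrow> 4 / pi"
proof -
  define W :: "nat \<Rightarrow> real" where "W N = (\<Prod>k = 1..N. (4 * (real k)\<^sup>2) / (4 * (real k)\<^sup>2 - 1))" for N
  have W: "W \<longlonglongrightarrow> pi / 2"
    using wallis unfolding W_def .
  have "(\<lambda>N. 2 - 1 / (real N + real 1)) \<longlonglongrightarrow> 2 - 0"
    by (intro tendsto_diff tendsto_const tendsto_const_over_shift)
  also have "(\<lambda>N. 2 - 1 / (real N + real 1)) = (\<lambda>N. (2 * real N + 1) / (real N + 1))"
    by (auto simp: field_simps)
  finally have "(\<lambda>N. (2 * real N + 1) / (real N + 1)) \<longlonglongrightarrow> 2"
    by simp
  from tendsto_divide[OF this W] have "(\<lambda>N. (2 * real N + 1) / (real N + 1) / W N) \<longlonglongrightarrow> 4 / pi"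
    by simp
  moreover have "(2 * real N + 1) / (real N + 1) / W N = lag_first (Suc N)" for N
  proof -
    have "(2 * real N + 1) / (real N + 1) \<noteq> 0" by (simp add: add_nonneg_eq_0_iff)
    moreover have "lag_first (Suc N) * W N = (2 * real N + 1) / (real N + 1)"
      unfolding W_def by (rule lag_first_wallis)
    ultimately show ?thesis by (metis mult_zero_right nonzero_eq_divide_eq)
  qed
  ultimately show ?thesis by (subst filterlim_sequentially_Suc[symmetric]) simp
qed

lemma lag_coeff_tendsto: "lag_coeff (Suc n) \<longlonglongrightarrow> 4 / pi * (-1) ^ n"
proof -
  have "(\<lambda>N. - (real N - real i) / (real N + real i)) \<longlonglongrightarrow> -1" if "1 \<le> i" for i
  proof -
    have "(\<lambda>N. 2 * real i / (real N + real i) - 1) \<longlonglongrightarrow> 0 - 1"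
      by (intro tendsto_diff tendsto_const tendsto_const_over_shift)
    also have "(\<lambda>N. 2 * real i / (real N + real i) - 1) = (\<lambda>N. - (real N - real i) / (real N + real i))"
      using that by (auto simp: field_simps)
    finally show ?thesis by simp
  qed
  hence "(\<lambda>N. lag_ratio (Suc n) N) \<longlonglongrightarrow> (\<Prod>i = 1..<Suc n. -1)"
    unfolding lag_ratio_def by (intro tendsto_prod) auto
  thus ?thesis unfolding lag_coeff_def by (intro tendsto_mult lag_first_tendsto) simp
qed

text \<open>The bound is uniform in both arguments, as the majorant in Tannery's theorem requires:
  every factor of \<open>lag_ratio\<close> has absolute value at most 1, and
  \<open>lag_first\<close> converges.\<close>

lemma lag_coeff_bounded: "\<exists>C. \<forall>n N. \<bar>lag_coeff n N\<bar> \<le> C"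
proof -
  have "Bseq lag_first"
    using lag_first_tendsto by (intro convergent_imp_Bseq) (auto simp: convergent_def)
  then obtain C where C: "\<bar>lag_first N\<bar> \<le> C" for N
    by (auto simp: Bseq_def)
  have "\<bar>lag_ratio n N\<bar> \<le> 1" for n N
    unfolding lag_ratio_def abs_prod
    by (intro prod_le_1) (auto simp: abs_divide divide_le_eq_1)
  hence "\<bar>lag_coeff n N\<bar> \<le> C * 1" for n N
    unfolding lag_coeff_def abs_mult using C[of N] by (intro mult_mono) auto
  thus ?thesis by auto
qed

lemma lag_coeff_sum_tendsto:
  assumes "summable (\<lambda>n. \<bar>g (Suc n)\<bar>)"
  shows "(\<lambda>N. \<Sum>n = 1..N. lag_coeff n N * g n) \<longlonglongrightarrow> 4 / pi * (\<Sum>n. (-1) ^ n * g (Suc n))"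
proof -
  obtain C where C: "\<And>n N. \<bar>lag_coeff n N\<bar> \<le> C"
    using lag_coeff_bounded by blast
  have "(\<lambda>N. \<Sum>n. lag_coeff (Suc n) N * g (Suc n)) \<longlonglongrightarrow> (\<Sum>n. 4 / pi * (-1) ^ n * g (Suc n))"
  proof (rule conjunct2[OF conjunct2[OF tannerys_theorem]])
    show "\<forall>\<^sub>F (n, N) in at_top \<times>\<^sub>F sequentially. norm (lag_coeff (Suc n) N * g (Suc n)) \<le> C * \<bar>g (Suc n)\<bar>"
      using C by (intro always_eventually) (auto simp: abs_mult intro!: mult_right_mono)
    show "(\<lambda>N. lag_coeff (Suc n) N * g (Suc n)) \<longlonglongrightarrow> 4 / pi * (-1) ^ n * g (Suc n)" for n
      by (intro tendsto_mult lag_coeff_tendsto tendsto_const)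
  qed (use assms in \<open>auto intro!: summable_mult\<close>)
  moreover have "(\<Sum>n. 4 / pi * (-1) ^ n * g (Suc n)) = 4 / pi * (\<Sum>n. (-1) ^ n * g (Suc n))"
    using suminf_mult[of "\<lambda>n. (-1) ^ n * g (Suc n)" "4 / pi"] assms
    by (simp add: mult.assoc summable_rabs_cancel abs_mult)
  \<comment> \<open>The series is a finite sum because the weights vanish for n > N. This needs N
    \<ge> 1: \<open>lag_coeff n 0\<close> is 1.\<close>
  moreover have "\<forall>\<^sub>F N in sequentially. (\<Sum>n. lag_coeff (Suc n) N * g (Suc n)) = (\<Sum>n = 1..N. lag_coeff n N * g n)"
    using eventually_ge_at_top[of 1]
  proof eventually_elim
    case (elim N)
    have "(\<Sum>n. lag_coeff (Suc n) N * g (Suc n)) = (\<Sum>n<N. lag_coeff (Suc n) N * g (Suc n))"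
      using elim by (intro suminf_finite) (auto simp: lag_coeff_eq_0)
    thus ?case using sum.atLeast1_atMost_eq[of "\<lambda>n. lag_coeff n N * g n" N] by simp
  qed
  ultimately show ?thesis by (simp add: filterlim_cong)
qed

section \<open>Growth of the iterated averages\<close>

lemma sum_inverse_sqrt_le: "(\<Sum>l = 1..n. 1 / sqrt (real l)) \<le> 2 * sqrt (real n)"
proof (induction n)
  case (Suc n)
  define x y where "x = sqrt (real n)" and "y = sqrt (real n + 1)"
  have xy: "x \<ge> 0" "y\<^sup>2 = x\<^sup>2 + 1" "x \<le> y" "y > 0" by (simp_all add: x_def y_def)
  \<comment> \<open>Since \<open>y^2 = x^2 + 1\<close>, this reads
    \<open>2 * x * y + 1 \<le> 2 * y^2\<close>; division by \<open>y\<close> gives the induction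
    step.\<close>
  have "2 * x * y \<le> x\<^sup>2 + y\<^sup>2"
    using sum_squares_bound[of x y] by simp
  hence "2 * x * y + 1 \<le> 2 * y\<^sup>2" using xy(2) by simp
  hence "2 * x + 1 / y \<le> 2 * y" using xy(4) by (simp add: field_simps power2_eq_square)
  thus ?case using Suc by (simp add: x_def y_def add.commute)
qed simp

text \<open>Decay of order 1/sqrt(n) is preserved by \<open>odd_avg\<close>, whereas decay of order
  1/n would pick up a logarithm at each application. The constant 5 is 1 for \<open>f n\<close> plus
  2 * 2 for the doubled sum.\<close>

lemma odd_avg_bound:
  assumes f: "\<And>n. 1 \<le> n \<Longrightarrow> \<bar>f n\<bar> \<le> C / sqrt (real n)" and n: "1 \<le> n"
  shows "\<bar>odd_avg f n\<bar> \<le> 5 * C / sqrt (real n)"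
proof -
  have C: "C \<ge> 0" using f[of 1] by simp
  have "\<bar>\<Sum>l = 1..<n. f l\<bar> \<le> (\<Sum>l = 1..<n. C * (1 / sqrt (real l)))"
    using f by (intro order.trans[OF sum_abs] sum_mono) auto
  also have "\<dots> \<le> (\<Sum>l = 1..n. C * (1 / sqrt (real l)))"
    using C by (intro sum_mono2) auto
  also have "\<dots> \<le> C * (2 * sqrt (real n))"
    using C sum_inverse_sqrt_le[of n] by (simp only: sum_distrib_left[symmetric] mult_left_mono)
  finally have 1: "\<bar>\<Sum>l = 1..<n. f l\<bar> \<le> 2 * C * sqrt (real n)" by simp
  have "C / sqrt (real n) \<le> C / 1" "C * 1 \<le> C * sqrt (real n)"
    using C n by (intro divide_left_mono mult_left_mono; simp)+
  hence "\<bar>f n + 2 * (\<Sum>l = 1..<n. f l)\<bar> \<le> 5 * C * sqrt (real n)"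
    using 1 f[OF n] by linarith
  hence "\<bar>odd_avg f n\<bar> \<le> 5 * C * sqrt (real n) / real n"
    unfolding odd_avg_def abs_divide using n C odd_num_ge[OF n] by (intro frac_le) auto
  also have "\<dots> = 5 * C / sqrt (real n)"
    using n by (simp add: field_simps)
  finally show ?thesis .
qed

lemma odd_avg_iterate_bound:
  "\<exists>C. \<forall>n\<ge>1. \<bar>(odd_avg ^^ p) (odd_recip (Suc q)) n\<bar> \<le> C / sqrt (real n)"
proof (induction p)
  case 0
  have "\<bar>odd_recip (Suc q) n\<bar> \<le> 1 / sqrt (real n)" if n: "1 \<le> n" for n
  proof -
    have "sqrt (real n) \<le> sqrt (real n * real n)" using n by (intro real_sqrt_le_mono) auto
    also have "\<dots> = real n" by simp
    also have "\<dots> \<le> odd_num n ^ 1" using odd_num_ge[OF n] by simp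
    also have "\<dots> \<le> odd_num n ^ Suc q" using n by (intro power_increasing) (auto simp: odd_num_def)
    finally show ?thesis using n odd_num_pos[OF n] by (simp add: frac_le)
  qed
  thus ?case by auto
next
  case (Suc p)
  then obtain C where "\<And>n. 1 \<le> n \<Longrightarrow> \<bar>(odd_avg ^^ p) (odd_recip (Suc q)) n\<bar> \<le> C / sqrt (real n)"
    by auto
  from odd_avg_bound[OF this] show ?case by auto
qed

text \<open>The 1/sqrt(n) bound together with at least one factor 1/n gives the summable exponent
  -3/2.\<close>

lemma odd_avg_iterate_summable:
  "summable (\<lambda>n. \<bar>(odd_avg ^^ p) (odd_recip (Suc q)) (Suc n) / odd_num (Suc n) ^ Suc a\<bar>)"
proof -
  obtain C where C: "\<And>n. 1 \<le> n \<Longrightarrow> \<bar>(odd_avg ^^ p) (odd_recip (Suc q)) n\<bar> \<le> C / sqrt (real n)"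
    using odd_avg_iterate_bound by blast
  have "summable (\<lambda>n. real n powr (-3/2))"
    by (subst summable_real_powr_iff) simp
  hence S: "summable (\<lambda>n. C * real (Suc n) powr (-3/2))"
    by (intro summable_mult) (subst summable_Suc_iff)
  show ?thesis
  proof (rule summable_comparison_test'[OF S])
    fix n :: nat
    define m where "m = Suc n"
    have m: "1 \<le> m" by (simp add: m_def)
    have "real m \<le> odd_num m ^ 1" using odd_num_ge[OF m] by simp
    also have "\<dots> \<le> odd_num m ^ Suc a" using m by (intro power_increasing) (auto simp: odd_num_def)
    finally have 1: "real m \<le> odd_num m ^ Suc a" .
    have "\<bar>(odd_avg ^^ p) (odd_recip (Suc q)) m / odd_num m ^ Suc a\<bar> =
        \<bar>(odd_avg ^^ p) (odd_recip (Suc q)) m\<bar> / odd_num m ^ Suc a"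
      using odd_num_pos[OF m] by (simp add: abs_divide abs_mult power_abs)
    also have "\<dots> \<le> (C / sqrt (real m)) / real m"
      using C[OF m] 1 m by (intro frac_le) (auto intro: order.trans[OF abs_ge_zero])
    also have "\<dots> = C * real m powr (-3/2)"
    proof -
      have "real m powr (3/2) = real m powr (1/2) * real m powr 1"
        by (subst powr_add[symmetric]) simp
      thus ?thesis using m by (simp add: powr_minus_divide powr_half_sqrt)
    qed
    finally show "norm \<bar>(odd_avg ^^ p) (odd_recip (Suc q)) (Suc n) / odd_num (Suc n) ^ Suc a\<bar> \<le>
        C * real (Suc n) powr (-3/2)" by (simp only: m_def real_norm_def abs_abs)
  qed
qed

section \<open>Infinite sums over index chains as limits of nested sums\<close>

definition bounded_chains :: "nat \<Rightarrow> nat \<Rightarrow> nat \<Rightarrow> nat list set" where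
  "bounded_chains d L N = {k. length k = L \<and> sorted_wrt (\<lambda>x y. y + d \<le> x) k \<and> (\<forall>x\<in>set k. 1 \<le> x \<and> x \<le> N)}"

lemma finite_bounded_chains: "finite (bounded_chains d L N)"
  by (rule finite_subset[OF _ finite_lists_length_eq[of "{..N}" L]]) (auto simp: bounded_chains_def)

lemma Cons_in_bounded_chains_iff:
  "n # k \<in> bounded_chains d (Suc L) N \<longleftrightarrow> n \<in> {1..N} \<and> k \<in> bounded_chains d L (n - d)"
proof -
  have "(\<forall>x\<in>set k. x + d \<le> n) \<and> (\<forall>x\<in>set k. 1 \<le> x \<and> x \<le> N) \<longleftrightarrow> (\<forall>x\<in>set k. 1 \<le> x \<and> x \<le> n - d)"
    if "n \<le> N"
  proof -
    have "x + d \<le> n \<and> 1 \<le> x \<and> x \<le> N \<longleftrightarrow> 1 \<le> x \<and> x \<le> n - d" for x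
      using that by auto
    thus ?thesis by blast
  qed
  thus ?thesis unfolding bounded_chains_def by auto
qed

lemma bounded_chains_Suc: "bounded_chains d (Suc L) N = (\<lambda>(n, k). n # k) ` (SIGMA n:{1..N}. bounded_chains d L (n - d))"
proof (intro equalityI subsetI)
  fix k assume k: "k \<in> bounded_chains d (Suc L) N"
  then obtain n ks where n: "k = n # ks" by (auto simp: bounded_chains_def length_Suc_conv)
  hence "(n, ks) \<in> (SIGMA n:{1..N}. bounded_chains d L (n - d))"
    using k unfolding n Cons_in_bounded_chains_iff by simp
  thus "k \<in> (\<lambda>(n, k). n # k) ` (SIGMA n:{1..N}. bounded_chains d L (n - d))"
    unfolding n by (rule rev_image_eqI) simp
next
  fix k assume "k \<in> (\<lambda>(n, k). n # k) ` (SIGMA n:{1..N}. bounded_chains d L (n - d))"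
  then obtain n ks where "k = n # ks" "n \<in> {1..N}" "ks \<in> bounded_chains d L (n - d)" by auto
  thus "k \<in> bounded_chains d (Suc L) N" by (simp only: Cons_in_bounded_chains_iff)
qed

lemma nested_sum_eq_sum_bounded_chains:
  "nested_sum d fs N = (\<Sum>k \<in> bounded_chains d (length fs) N. \<Prod>j<length fs. (fs ! j) (k ! j))"
proof (induction fs arbitrary: N)
  case Nil
  have "bounded_chains d 0 N = {[]}" by (auto simp: bounded_chains_def)
  thus ?case by simp
next
  case (Cons f fs)
  have inj: "inj_on (\<lambda>(n, k). n # k) B" for B :: "(nat \<times> nat list) set"
    by (auto simp: inj_on_def)
  have "(\<Sum>k \<in> bounded_chains d (Suc (length fs)) N. \<Prod>j<Suc (length fs). ((f # fs) ! j) (k ! j)) =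
      (\<Sum>(n, k) \<in> (SIGMA n:{1..N}. bounded_chains d (length fs) (n - d)). f n * (\<Prod>j<length fs. (fs ! j) (k ! j)))"
    unfolding bounded_chains_Suc sum.reindex[OF inj]
    by (intro sum.cong refl) (simp add: split_def prod.lessThan_Suc_shift del: prod.lessThan_Suc)
  also have "\<dots> = nested_sum d (f # fs) N"
    by (subst sum.Sigma[symmetric]) (auto simp: finite_bounded_chains Cons sum_distrib_left)
  finally show ?case by simp
qed

text \<open>The bounded chains eventually contain every finite set of admissible chains, so they run
  through the filter of finite subsets. The bound on the absolute sums supplies summability, without
  which \<open>infsum\<close> would take its default value 0.\<close>

lemma nested_sum_tendsto_infsum:
  assumes bdd: "\<And>N. nested_sum d (map (\<lambda>f k. \<bar>f k\<bar>) fs) N \<le> C"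
  shows "(\<lambda>N. nested_sum d fs N) \<longlonglongrightarrow>
    infsum (\<lambda>k. \<Prod>j<length fs. (fs ! j) (k ! j))
      {k. length k = length fs \<and> sorted_wrt (\<lambda>x y. y + d \<le> x) k \<and> (\<forall>x\<in>set k. 1 \<le> x)}"
proof -
  define A where "A = {k :: nat list. length k = length fs \<and> sorted_wrt (\<lambda>x y. y + d \<le> x) k \<and> (\<forall>x\<in>set k. 1 \<le> x)}"
  define F where "F k = (\<Prod>j<length fs. (fs ! j) (k ! j))" for k :: "nat list"
  have sub: "bounded_chains d (length fs) N \<subseteq> A" for N
    by (auto simp: A_def bounded_chains_def)
  have cover: "\<exists>M. \<forall>N\<ge>M. X \<subseteq> bounded_chains d (length fs) N" if X: "finite X" "X \<subseteq> A" for X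
  proof -
    define M where "M = Max (\<Union> (set ` X))"
    have M: "x \<le> M" if "k \<in> X" "x \<in> set k" for k x
      unfolding M_def using that X(1) by (intro Max_ge) auto
    have "k \<in> bounded_chains d (length fs) N" if "M \<le> N" "k \<in> X" for k N
    proof -
      have "\<forall>x\<in>set k. x \<le> N" using M[OF that(2)] that(1) by (blast intro: order.trans)
      moreover have "k \<in> A" using that(2) X(2) by blast
      ultimately show ?thesis unfolding A_def bounded_chains_def by blast
    qed
    thus ?thesis by blast
  qed
  have lim: "filterlim (bounded_chains d (length fs)) (finite_subsets_at_top A) sequentially"
    unfolding filterlim_finite_subsets_at_top eventually_sequentially
  proof (intro allI impI)
    fix X assume "finite X \<and> X \<subseteq> A"
    then obtain M where "\<forall>N\<ge>M. X \<subseteq> bounded_chains d (length fs) N" using cover by blast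
    thus "\<exists>M. \<forall>N\<ge>M. finite (bounded_chains d (length fs) N) \<and> X \<subseteq> bounded_chains d (length fs) N \<and> bounded_chains d (length fs) N \<subseteq> A"
      using finite_bounded_chains sub by blast
  qed
  have abs: "nested_sum d (map (\<lambda>f k. \<bar>f k\<bar>) fs) N = (\<Sum>k \<in> bounded_chains d (length fs) N. \<bar>F k\<bar>)" for N
    unfolding nested_sum_eq_sum_bounded_chains F_def abs_prod length_map
    by (intro sum.cong prod.cong refl) simp
  have "(\<lambda>k. \<bar>F k\<bar>) summable_on A"
  proof (rule nonneg_bdd_above_summable_on)
    have "sum (\<lambda>k. \<bar>F k\<bar>) X \<le> C" if X: "X \<subseteq> A" "finite X" for X
    proof -
      obtain N where "X \<subseteq> bounded_chains d (length fs) N" using cover[OF X(2,1)] by blast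
      hence "sum (\<lambda>k. \<bar>F k\<bar>) X \<le> (\<Sum>k \<in> bounded_chains d (length fs) N. \<bar>F k\<bar>)"
        by (intro sum_mono2 finite_bounded_chains) auto
      thus ?thesis using bdd[of N] abs[of N] by linarith
    qed
    thus "bdd_above (sum (\<lambda>k. \<bar>F k\<bar>) ` {X. X \<subseteq> A \<and> finite X})"
      by (intro bdd_aboveI2[of _ _ C]) blast
  qed simp
  hence "F summable_on A"
    by (rule iffD2[OF summable_on_iff_abs_summable_on_real, unfolded real_norm_def])
  hence "(F has_sum infsum F A) A" by (rule has_sum_infsum)
  hence "filterlim (sum F) (nhds (infsum F A)) (finite_subsets_at_top A)"
    unfolding has_sum_def .
  from filterlim_compose[OF this lim] show ?thesis
    unfolding nested_sum_eq_sum_bounded_chains F_def A_def .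
qed

lemma nested_sum_abs_odd_recip:
  "nested_sum d (map (\<lambda>f k. \<bar>f k\<bar>) (map odd_recip s)) N = nested_sum d (map odd_recip s) N"
  by (induction s arbitrary: N) (auto simp: odd_num_def intro!: sum.cong)

section \<open>The weighted sum over compositions\<close>

text \<open>The part of the t-value with largest index n, stripped of the sign and of the power
  \<open>2 * a + 1\<close> of \<open>odd_num n\<close>. In this form the dependence on the
  composition is recursive in its first part.\<close>

fun comp_term :: "nat \<Rightarrow> nat list \<Rightarrow> nat \<Rightarrow> real" where
  "comp_term b [] n = 0"
| "comp_term b [x] n = odd_recip (x + 2 * b + 1) n"
| "comp_term b (x # y # ys) n = odd_recip x n * (\<Sum>l = 1..<n. comp_term b (y # ys) l)"

definition shift_last :: "nat \<Rightarrow> nat list \<Rightarrow> nat list" where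
  "shift_last b s = butlast s @ [last s + 2 * b + 1]"

text \<open>Separates the shift of the first entry, which becomes a division by
  \<open>odd_num n ^ (2 * a + 1)\<close>. For a one-part composition both shifts fall on the same
  entry, and this form covers that case too.\<close>

lemma shift_ends_Cons:
  assumes "s \<noteq> []"
  shows "shift_ends a b s = (2 * a + 1 + hd (shift_last b s)) # tl (shift_last b s)"
proof (rule nth_equalityI)
  show len: "length (shift_ends a b s) = length ((2 * a + 1 + hd (shift_last b s)) # tl (shift_last b s))"
    using assms by (simp add: shift_ends_def shift_last_def)
  fix i assume "i < length (shift_ends a b s)"
  hence i: "i < length s" by (simp add: shift_ends_def)
  have ne: "shift_last b s \<noteq> []" by (simp add: shift_last_def)
  have "shift_last b s ! i = s ! i + (if i = length s - 1 then 2 * b + 1 else 0)"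
    using i assms by (auto simp: shift_last_def nth_append nth_butlast last_conv_nth)
  moreover have "((2 * a + 1 + hd (shift_last b s)) # tl (shift_last b s)) ! i =
      shift_last b s ! i + (if i = 0 then 2 * a + 1 else 0)"
    using ne by (cases "shift_last b s"; cases i) auto
  ultimately show "shift_ends a b s ! i = ((2 * a + 1 + hd (shift_last b s)) # tl (shift_last b s)) ! i"
    using i by (simp add: shift_ends_def)
qed

lemma comp_term_eq_nested_sum:
  assumes "s \<noteq> []"
  shows "comp_term b s n = odd_recip (hd (shift_last b s)) n *
    nested_sum 1 (map odd_recip (tl (shift_last b s))) (n - 1)"
  using assms
proof (induction b s n rule: comp_term.induct)
  case (3 b x y ys n)
  have "shift_last b (x # y # ys) = x # shift_last b (y # ys)"
    by (simp add: shift_last_def)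
  moreover obtain z zs where "shift_last b (y # ys) = z # zs"
    by (cases "shift_last b (y # ys)") (auto simp: shift_last_def)
  moreover have "{1..<n} = {1..n - 1}" by auto
  ultimately show ?case using 3 by simp
qed (simp_all add: shift_last_def)

lemma comp_term_nonneg: "comp_term b s n \<ge> 0" if "1 \<le> n"
  using that by (induction b s n rule: comp_term.induct)
    (auto intro!: sum_nonneg mult_nonneg_nonneg divide_nonneg_pos zero_le_power simp: odd_num_def)

definition all_comps :: "nat \<Rightarrow> nat list set" where
  "all_comps p = {s. (\<forall>x\<in>set s. 1 \<le> x) \<and> sum_list s = p}"

lemma length_le_sum_list: "(\<forall>x\<in>set s. 1 \<le> x) \<Longrightarrow> length s \<le> sum_list s" for s :: "nat list"
  by (induction s) auto

lemma finite_all_comps: "finite (all_comps p)"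
  by (rule finite_subset[OF _ finite_lists_length_le[of "{..p}" p]])
    (auto simp: all_comps_def length_le_sum_list dest: member_le_sum_list)

lemma sum_compositions:
  assumes "1 \<le> p"
  shows "(\<Sum>r = 1..p. \<Sum>s \<in> compositions p r. f s) = (\<Sum>s \<in> all_comps p. f s)"
proof -
  have eq: "compositions p r = {s \<in> all_comps p. length s = r}" for r
    by (auto simp: compositions_def all_comps_def)
  have "length s \<in> {1..p}" if "s \<in> all_comps p" for s
    using that length_le_sum_list[of s] assms by (cases s) (auto simp: all_comps_def)
  thus ?thesis unfolding eq by (intro sum.group) (auto simp: finite_all_comps)
qed

fun incr_hd :: "nat list \<Rightarrow> nat list" where
  "incr_hd [] = []"
| "incr_hd (x # xs) = Suc x # xs"

lemma all_comps_nonempty: "1 \<le> p \<Longrightarrow> s \<in> all_comps p \<Longrightarrow> s \<noteq> []"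
  by (auto simp: all_comps_def)

text \<open>The two images collect the compositions with first part at least 2 and with first part
  1. For p = 0 the claim fails, since \<open>incr_hd []\<close> is again empty.\<close>

lemma all_comps_Suc:
  assumes "1 \<le> p"
  shows "all_comps (Suc p) = incr_hd ` all_comps p \<union> (#) 1 ` all_comps p"
proof (intro equalityI subsetI)
  fix s assume s: "s \<in> all_comps (Suc p)"
  then obtain x xs where xs: "s = x # xs" by (cases s) (auto simp: all_comps_def)
  show "s \<in> incr_hd ` all_comps p \<union> (#) 1 ` all_comps p"
  proof (cases "x = 1")
    case True
    thus ?thesis using s xs by (auto simp: all_comps_def)
  next
    case False
    hence "s = incr_hd ((x - 1) # xs)" "(x - 1) # xs \<in> all_comps p"
      using s xs by (auto simp: all_comps_def)
    thus ?thesis by blast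
  qed
next
  fix s assume "s \<in> incr_hd ` all_comps p \<union> (#) 1 ` all_comps p"
  then obtain t where t: "t \<in> all_comps p" "s = incr_hd t \<or> s = 1 # t" by blast
  moreover have "t \<noteq> []" using t(1) assms all_comps_nonempty by blast
  ultimately show "s \<in> all_comps (Suc p)" by (cases t) (auto simp: all_comps_def)
qed

definition comp_sum :: "nat \<Rightarrow> nat \<Rightarrow> nat \<Rightarrow> real" where
  "comp_sum b p n = (\<Sum>s \<in> all_comps p. 2 ^ length s * comp_term b s n)"

lemma comp_sum_1: "comp_sum b 1 n = 2 * odd_recip (2 * b + 2) n"
proof -
  have "all_comps 1 = {[1]}"
  proof (intro equalityI subsetI)
    fix s assume "s \<in> all_comps 1"
    moreover from this have "length s \<le> 1" using length_le_sum_list[of s] by (auto simp: all_comps_def)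
    ultimately show "s \<in> {[1]}" by (cases s) (auto simp: all_comps_def)
  qed (auto simp: all_comps_def)
  thus ?thesis by (simp add: comp_sum_def)
qed

text \<open>\<open>incr_hd\<close> keeps the length and divides the term by
  \<open>odd_num n\<close>. Prepending 1 lengthens the list, hence the factor 2, and introduces the
  sum over l < n. Together these are the two terms of \<open>odd_avg\<close>.\<close>

lemma comp_sum_Suc:
  assumes "1 \<le> p"
  shows "comp_sum b (Suc p) n = odd_avg (comp_sum b p) n"
proof -
  have ne: "s \<noteq> []" if "s \<in> all_comps p" for s
    using all_comps_nonempty[OF assms that] .
  have incr: "2 ^ length (incr_hd s) * comp_term b (incr_hd s) n =
      2 ^ length s * comp_term b s n / odd_num n" if "s \<in> all_comps p" for s
    using ne[OF that] by (cases "(b, s, n)" rule: comp_term.cases) auto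
  have cons: "2 ^ length (1 # s) * comp_term b (1 # s) n =
      (\<Sum>l = 1..<n. 2 * (2 ^ length s * comp_term b s l)) / odd_num n" if "s \<in> all_comps p" for s
    using ne[OF that] by (cases s) (auto simp: sum_distrib_left sum_divide_distrib mult_ac)
  have inj: "inj_on incr_hd (all_comps p)"
  proof (rule inj_onI)
    fix s t assume "s \<in> all_comps p" "t \<in> all_comps p" "incr_hd s = incr_hd t"
    thus "s = t" using ne by (cases s; cases t) auto
  qed
  have "incr_hd s \<noteq> 1 # t" if "s \<in> all_comps p" for s t
    using that ne[OF that] by (cases s) (auto simp: all_comps_def)
  hence disj: "incr_hd ` all_comps p \<inter> (#) 1 ` all_comps p = {}" by blast
  have "comp_sum b (Suc p) n = (\<Sum>s \<in> incr_hd ` all_comps p. 2 ^ length s * comp_term b s n) +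
      (\<Sum>s \<in> (#) 1 ` all_comps p. 2 ^ length s * comp_term b s n)"
    unfolding comp_sum_def all_comps_Suc[OF assms]
    by (rule sum.union_disjoint) (auto simp: finite_all_comps disj simp del: One_nat_def)
  also have "(\<Sum>s \<in> incr_hd ` all_comps p. 2 ^ length s * comp_term b s n) = comp_sum b p n / odd_num n"
    by (subst sum.reindex[OF inj]) (simp add: incr comp_sum_def sum_divide_distrib)
  also have "(\<Sum>s \<in> (#) 1 ` all_comps p. 2 ^ length s * comp_term b s n) =
      (\<Sum>s \<in> all_comps p. (\<Sum>l = 1..<n. 2 * (2 ^ length s * comp_term b s l)) / odd_num n)"
    by (subst sum.reindex, simp, intro sum.cong refl) (simp only: o_apply cons)
  also have "\<dots> = 2 * (\<Sum>l = 1..<n. comp_sum b p l) / odd_num n"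
    unfolding comp_sum_def sum_divide_distrib[symmetric]
    by (subst sum.swap) (simp add: sum_distrib_left)
  finally show ?thesis by (simp add: odd_avg_def add_divide_distrib)
qed

lemma odd_avg_scale: "odd_avg (\<lambda>n. c * f n) n = c * odd_avg f n"
  by (simp add: odd_avg_def sum_distrib_left[symmetric] algebra_simps)

text \<open>The factor 2 is the weight of the only composition of 1. Compared with
  \<open>odd_transform_iterate\<close>, this links the two sides of the identity.\<close>

lemma comp_sum_eq_iterate: "comp_sum b (Suc p) n = 2 * (odd_avg ^^ p) (odd_recip (2 * b + 2)) n"
proof (induction p arbitrary: n)
  case 0
  show ?case using comp_sum_1[of b n] by simp
next
  case (Suc p)
  have "comp_sum b (Suc (Suc p)) n = odd_avg (comp_sum b (Suc p)) n"
    by (rule comp_sum_Suc) simp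
  also have "comp_sum b (Suc p) = (\<lambda>n. 2 * (odd_avg ^^ p) (odd_recip (2 * b + 2)) n)"
    by (intro ext Suc.IH)
  also have "odd_avg \<dots> n = 2 * odd_avg ((odd_avg ^^ p) (odd_recip (2 * b + 2))) n"
    by (rule odd_avg_scale)
  finally show ?case by simp
qed

section \<open>Convergence of both sides and conclusion\<close>

text \<open>Absolute convergence needs no separate estimate for each t-value: all
  \<open>comp_term\<close> values are nonnegative, so a single one is dominated by the whole
  \<open>comp_sum\<close>, whose growth is known from the iterates of
  \<open>odd_avg\<close>.\<close>

lemma tval_tendsto:
  assumes s: "s \<in> all_comps (Suc p)"
  shows "(\<lambda>N. \<Sum>n = 1..N. (-1) ^ n * (comp_term b s n / odd_num n ^ (2 * a + 1))) \<longlonglongrightarrow>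
    tval (shift_ends a b s) ((-1) # replicate (length s - 1) 1)"
proof -
  have ne: "s \<noteq> []" using all_comps_nonempty[OF _ s] by simp
  obtain x xs where sl: "shift_last b s = x # xs"
    by (cases "shift_last b s") (auto simp: shift_last_def)
  have se: "shift_ends a b s = (2 * a + 1 + x) # xs"
    using shift_ends_Cons[OF ne] sl by simp
  have len: "length xs = length s - 1"
    using arg_cong[OF sl, of length] ne by (simp add: shift_last_def)
  define fs where "fs = (\<lambda>k. (-1) ^ k * odd_recip (2 * a + 1 + x) k) # map odd_recip xs"
  have ct: "comp_term b s n = odd_recip x n * nested_sum 1 (map odd_recip xs) (n - 1)" for n
    using comp_term_eq_nested_sum[OF ne, of b n] sl by simp
  have 1: "nested_sum 1 fs N = (\<Sum>n = 1..N. (-1) ^ n * (comp_term b s n / odd_num n ^ (2 * a + 1)))" for N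
    by (simp add: fs_def ct power_add mult_ac)
  define g where "g n = (odd_avg ^^ p) (odd_recip (2 * b + 2)) n / odd_num n ^ (2 * a + 1)" for n
  have g: "summable (\<lambda>n. \<bar>g (Suc n)\<bar>)"
    using odd_avg_iterate_summable[of p "2 * b + 1" "2 * a"] by (simp add: g_def)
  have term_le: "comp_term b s n / odd_num n ^ (2 * a + 1) \<le> 2 * \<bar>g n\<bar>" if n: "1 \<le> n" for n
  proof -
    have "comp_term b s n \<le> 2 ^ length s * comp_term b s n"
      using mult_right_mono[of 1 "2 ^ length s", OF _ comp_term_nonneg[OF n]] by simp
    also have "\<dots> \<le> comp_sum b (Suc p) n"
      unfolding comp_sum_def using s comp_term_nonneg[OF n]
      by (intro member_le_sum) (auto simp: finite_all_comps)
    also have "\<dots> = 2 * (odd_avg ^^ p) (odd_recip (2 * b + 2)) n"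
      by (rule comp_sum_eq_iterate)
    finally have "comp_term b s n / odd_num n ^ (2 * a + 1) \<le> 2 * g n"
      using odd_num_pos[OF n] by (simp add: g_def divide_right_mono)
    thus ?thesis by linarith
  qed
  have bdd: "nested_sum 1 (map (\<lambda>f k. \<bar>f k\<bar>) fs) N \<le> 2 * (\<Sum>n. \<bar>g (Suc n)\<bar>)" for N
  proof -
    have "nested_sum 1 (map (\<lambda>f k. \<bar>f k\<bar>) fs) N = (\<Sum>n = 1..N. comp_term b s n / odd_num n ^ (2 * a + 1))"
      unfolding fs_def list.map nested_sum.simps(2) nested_sum_abs_odd_recip
    proof (intro sum.cong refl)
      fix n assume "n \<in> {1..N}"
      hence "\<bar>odd_num n\<bar> = odd_num n" using odd_num_pos[of n] by simp
      thus "\<bar>(-1) ^ n * odd_recip (2 * a + 1 + x) n\<bar> * nested_sum 1 (map odd_recip xs) (n - 1) =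
          comp_term b s n / odd_num n ^ (2 * a + 1)"
        by (simp add: ct power_add abs_mult power_abs mult_ac)
    qed
    also have "\<dots> \<le> (\<Sum>n = 1..N. 2 * \<bar>g n\<bar>)"
      using term_le by (intro sum_mono) auto
    also have "\<dots> = 2 * (\<Sum>n<N. \<bar>g (Suc n)\<bar>)"
      using sum.atLeast1_atMost_eq[of "\<lambda>n. \<bar>g n\<bar>" N] by (simp add: sum_distrib_left[symmetric])
    also have "\<dots> \<le> 2 * (\<Sum>n. \<bar>g (Suc n)\<bar>)"
      using sum_le_suminf[OF g, of "{..<N}"] by simp
    finally show ?thesis .
  qed
  have nth: "(fs ! j) k = (((-1) # replicate (length s - 1) 1) ! j) ^ k / odd_num k ^ (shift_ends a b s ! j)"
    if "j < length fs" for j k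
    using that by (cases j) (auto simp: fs_def se len)
  have "infsum (\<lambda>k. \<Prod>j<length fs. (fs ! j) (k ! j))
      {k. length k = length fs \<and> sorted_wrt (\<lambda>x y. y + 1 \<le> x) k \<and> (\<forall>x\<in>set k. 1 \<le> x)} =
      tval (shift_ends a b s) ((-1) # replicate (length s - 1) 1)"
    unfolding tval_def
  proof (rule infsum_cong_neutral)
    fix k :: "nat list"
    show "(\<Prod>j<length fs. (fs ! j) (k ! j)) =
      (\<Prod>j<length (shift_ends a b s). ((-1) # replicate (length s - 1) 1) ! j ^ (k ! j) /
        (2 * real (k ! j) - 1) ^ (shift_ends a b s ! j))"
    proof (rule prod.cong)
      show "{..<length fs} = {..<length (shift_ends a b s)}"
        by (simp add: fs_def se)
      show "(fs ! j) (k ! j) = ((-1) # replicate (length s - 1) 1) ! j ^ (k ! j) /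
        (2 * real (k ! j) - 1) ^ (shift_ends a b s ! j)" if "j \<in> {..<length (shift_ends a b s)}" for j
        using that nth[of j "k ! j"] by (simp add: odd_num_def) (simp add: fs_def se)
    qed
  qed (auto simp: fs_def se Suc_le_eq)
  with nested_sum_tendsto_infsum[OF bdd] show ?thesis by (simp only: 1)
qed

text \<open>The terms are positive, so convergence of the truncated sums already bounds the absolute
  sums.\<close>

lemma tstar_eq_limit:
  assumes "(\<lambda>N. nested_sum 0 (map odd_recip s) N) \<longlonglongrightarrow> L"
  shows "tstar s = L"
proof -
  have "Bseq (\<lambda>N. nested_sum 0 (map odd_recip s) N)"
    using assms by (intro convergent_imp_Bseq) (auto simp: convergent_def)
  then obtain C where "\<And>N. \<bar>nested_sum 0 (map odd_recip s) N\<bar> \<le> C"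
    by (auto simp: Bseq_def)
  hence "nested_sum 0 (map (\<lambda>f k. \<bar>f k\<bar>) (map odd_recip s)) N \<le> C" for N
    unfolding nested_sum_abs_odd_recip by (meson abs_le_D1)
  from nested_sum_tendsto_infsum[OF this]
  have "(\<lambda>N. nested_sum 0 (map odd_recip s) N) \<longlonglongrightarrow> tstar s"
    by (simp add: tstar_def odd_num_def)
  thus ?thesis using assms by (rule LIMSEQ_unique)
qed

theorem theorem4p4:
  fixes a b c :: nat
  assumes "1 \<le> c"
  shows "tstar (replicate a 2 @ [c + 3] @ replicate b 2) =
    - (2 / pi) * (\<Sum>r = 1..c + 2. 2 ^ r *
        (\<Sum>s \<in> compositions (c + 2) r. tval (shift_ends a b s) ((-1) # replicate (r - 1) 1)))"
proof -
  \<comment> \<open>The number of iterations is c + 1 because the middle argument is c + 3 = (c + 1)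
    + 2.\<close>
  define G where "G = (odd_avg ^^ (c + 1)) (odd_recip (2 * b + 2))"
  define g where "g n = G n / odd_num n ^ (2 * a + 1)" for n
  define S where "S = (\<Sum>n. (-1) ^ n * g (Suc n))"
  have g: "summable (\<lambda>n. \<bar>g (Suc n)\<bar>)"
    using odd_avg_iterate_summable[of "c + 1" "2 * b + 1" "2 * a"] by (simp add: g_def G_def)
  have "nested_sum 0 (map odd_recip (replicate a 2 @ [c + 3] @ replicate b 2)) N =
      (\<Sum>n = 1..N. lag_coeff n N * g n)" for N
  proof -
    have "nested_sum 0 (map odd_recip (replicate a 2 @ [c + 3] @ replicate b 2)) N =
        nested_sum 0 (replicate a (odd_recip 2) @ odd_recip (c + 1 + 2) # replicate b (odd_recip 2)) N"
      by (simp add: eval_nat_numeral)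
    also have "\<dots> = (\<Sum>n = 1..N. lag_coeff n N * g n)"
      unfolding nested_sum_leading_twos g_def G_def
      by (intro sum.cong refl) (subst odd_transform_iterate, auto)
    finally show ?thesis .
  qed
  hence tstar: "tstar (replicate a 2 @ [c + 3] @ replicate b 2) = 4 / pi * S"
    using lag_coeff_sum_tendsto[OF g] by (intro tstar_eq_limit) (simp_all only: S_def)
  let ?t = "\<lambda>s. tval (shift_ends a b s) ((-1) # replicate (length s - 1) 1)"
  have "(\<Sum>r = 1..c + 2. 2 ^ r *
        (\<Sum>s \<in> compositions (c + 2) r. tval (shift_ends a b s) ((-1) # replicate (r - 1) 1))) =
      (\<Sum>r = 1..c + 2. \<Sum>s \<in> compositions (c + 2) r. 2 ^ length s * ?t s)"
    by (intro sum.cong refl) (auto simp: sum_distrib_left compositions_def intro!: sum.cong)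
  also have "\<dots> = (\<Sum>s \<in> all_comps (c + 2). 2 ^ length s * ?t s)"
    by (rule sum_compositions) simp
  \<comment> \<open>Both values are limits of the same truncated sums. The 2 comes from
    \<open>comp_sum_eq_iterate\<close>; the minus sign from shifting the summation index, as the
    t-values carry \<open>(-1) ^ n\<close> where \<open>S\<close> has
    \<open>(-1) ^ (n - 1)\<close>.\<close>
  also have "\<dots> = - 2 * S"
  proof (rule LIMSEQ_unique)
    show "(\<lambda>N. \<Sum>s \<in> all_comps (c + 2). 2 ^ length s *
        (\<Sum>n = 1..N. (-1) ^ n * (comp_term b s n / odd_num n ^ (2 * a + 1)))) \<longlonglongrightarrow>
        (\<Sum>s \<in> all_comps (c + 2). 2 ^ length s * ?t s)"
      by (intro tendsto_sum tendsto_mult tendsto_const tval_tendsto[of _ "c + 1"]) simp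
    have "(\<Sum>s \<in> all_comps (c + 2). 2 ^ length s *
        (\<Sum>n = 1..N. (-1) ^ n * (comp_term b s n / odd_num n ^ (2 * a + 1)))) =
        - 2 * (\<Sum>n<N. (-1) ^ n * g (Suc n))" for N
    proof -
      have "(\<Sum>s \<in> all_comps (c + 2). 2 ^ length s *
          (\<Sum>n = 1..N. (-1) ^ n * (comp_term b s n / odd_num n ^ (2 * a + 1)))) =
          (\<Sum>n = 1..N. (-1) ^ n * (comp_sum b (Suc (c + 1)) n / odd_num n ^ (2 * a + 1)))"
        unfolding comp_sum_def sum_distrib_left sum_divide_distrib
        by (subst sum.swap) (simp add: mult_ac)
      also have "\<dots> = (\<Sum>n = 1..N. 2 * ((-1) ^ n * g n))"
        unfolding comp_sum_eq_iterate g_def G_def by (simp add: mult_ac)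
      also have "\<dots> = (\<Sum>n<N. 2 * ((-1) ^ Suc n * g (Suc n)))"
        unfolding One_nat_def by (rule sum.atLeast1_atMost_eq)
      also have "\<dots> = (\<Sum>n<N. - 2 * ((-1) ^ n * g (Suc n)))"
        by (intro sum.cong refl) simp
      also have "\<dots> = - 2 * (\<Sum>n<N. (-1) ^ n * g (Suc n))"
        by (rule sum_distrib_left[symmetric])
      finally show ?thesis .
    qed
    moreover have "(\<lambda>n. (-1) ^ n * g (Suc n)) sums S"
      unfolding S_def using g
      by (intro summable_sums) (rule summable_rabs_cancel, simp add: abs_mult)
    ultimately show "(\<lambda>N. \<Sum>s \<in> all_comps (c + 2). 2 ^ length s *
        (\<Sum>n = 1..N. (-1) ^ n * (comp_term b s n / odd_num n ^ (2 * a + 1)))) \<longlonglongrightarrow> - 2 * S"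
      by (simp only: sums_def) (intro tendsto_mult tendsto_const)
  qed
  finally show ?thesis unfolding tstar by simp
qed

end
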